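(* Suppose there exists a constant $\mu>0$ such that $\|A\|_{L_2(\Pi)}^2\ge \mu^{-2}\|A\|_2^2$ for all $A\in\mathbb{R}^{m_1\times m_2}$. Let $\varrho\ge 1$ and $\lambda>0$, let $\hat A$ be the rank penalized estimator with regularization parameter $\lambda$, and let $\Delta=\|M\|_\infty$. If $\sqrt{\lambda}\ge 2\varrho\mu\Delta$, then (i) $$\operatorname{rank}(\hat A)\le\left(1+\frac{2}{4\varrho^2-1}\right)\operatorname{rank}(A_0);$$ (ii) $$\|\hat A-A_0\|_{L_2(\Pi)}\le\inf_{A\in\mathbb{R}^{m_1\times m_2}}\left\{\|A-A_0\|_{L_2(\Pi)}+2\sqrt{\lambda\max\left(\frac{1}{\varrho^2}\operatorname{rank}(A_0),\operatorname{rank}(A)\right)}\right\};$$ (iii) $$\|\hat A-A_0\|_{L_2(\Pi)}^2\le\inf_{A\in\mathbb{R}^{m_1\times m_2}}\left\{\left(1+\frac{2}{2\varrho^2-1}\right)\|A-A_0\|_{L_2(\Pi)}^2+2\lambda\left(1+\frac{1}{2\varrho^2-1}\right)\operatorname{rank}(A)\right\}.$$ (These are pathwise statements: the conclusions hold for every realization of the data for which $\sqrt\lambda\ge 2\varrho\mu\Delta$.)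
   Context: Trace regression model: one observes $n$ independent random pairs $(X_i,Y_i)$, $i=1,\dots,n$, where $X_i$ is a random matrix in $\mathbb{R}^{m_1\times m_2}$ with known distribution $\Pi_i$ and $Y_i$ is a real random variable with $\mathbb{E}(Y_i\mid X_i)=\operatorname{tr}(X_i^TA_0)$, for an unknown fixed matrix $A_0\in\mathbb{R}^{m_1\times m_2}$. All expectations written below are assumed to be finite. Notation: $\langle A,B\rangle=\operatorname{tr}(A^TB)$; $\|A\|_q=(\sum_j\sigma_j(A)^q)^{1/q}$ for $0<q<\infty$ and $\|A\|_\infty=\sigma_1(A)$, where $\sigma_1(A)\ge\sigma_2(A)\ge\dots$ are the singular values of $A$ (so $\|\cdot\|_2$ is the Frobenius norm and $\|\cdot\|_\infty$ the spectral norm). With $\Pi=\frac1n\sum_{i=1}^n\Pi_i$, set $$\langle A,B\rangle_{L_2(\Pi)}=\frac1n\sum_{i=1}^n\mathbb{E}\big(\langle A,X_i\rangle\langle B,X_i\rangle\big),\qquad \|A\|_{L_2(\Pi)}^2=\langle A,A\rangle_{L_2(\Pi)}.$$ The noise matrix is $M=\frac1n\sum_{i=1}^n\big(Y_iX_i-\mathbb{E}(Y_iX_i)\big)$. The rank penalized estimator with parameter $\lambda>0$ is $$\hat A\in\operatorname*{arg\,min}_{A\in\mathbb{R}^{m_1\times m_2}}\left\{\|A\|_{L_2(\Pi)}^2-\Big\langle\frac2n\sum_{i=1}^nY_iX_i,A\Big\rangle+\lambda\operatorname{rank}(A)\right\}.$$ *)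

theory Defs
  imports "HOL-Probability.Probability" "HOL-Library.Multiset"
begin

definition mat_inner :: "real^'n^'m \<Rightarrow> real^'n^'m \<Rightarrow> real" where
  "mat_inner A B = trace (transpose A ** B)"

text \<open>
  Singular values in decreasing order: the nonnegative square roots of the eigenvalues of
  \<open>A\<^sup>T A\<close>, each repeated according to the dimension of its eigenspace (for a symmetric
  matrix this is also the algebraic multiplicity). For a matrix with \<open>n\<close> columns the list has
  length \<open>n\<close>; compared with the convention of listing only \<open>min m n\<close> values, it
  is merely padded with zeros.
\<close>
definition singular_values :: "real^'n^'m \<Rightarrow> real list" where
  "singular_values A = rev (sorted_list_of_multiset
     (\<Sum>s\<in>{s. 0 \<le> s \<and> (\<exists>v. v \<noteq> 0 \<and> (transpose A ** A) *v v = s\<^sup>2 *\<^sub>R v)}.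
        replicate_mset (dim {v. (transpose A ** A) *v v = s\<^sup>2 *\<^sub>R v}) s))"

definition schatten_norm :: "real \<Rightarrow> real^'n^'m \<Rightarrow> real" where
  "schatten_norm q A = (\<Sum>s\<leftarrow>singular_values A. s powr q) powr (1 / q)"

definition spectral_norm :: "real^'n^'m \<Rightarrow> real" where
  "spectral_norm A = hd (singular_values A)"

text \<open>
  Measurability of the pairs is part of \<^const>\<open>prob_space.indep_vars\<close>. The conditional
  expectation given \<open>X i\<close> is the one with respect to the sigma-algebra generated by \<open>X i\<close>.
  The three integrability assumptions express that the expectations occurring in the model
  are finite.
\<close>
locale trace_regression = prob_space P
  for P :: "'w measure" +
  fixes n :: nat
    and X :: "nat \<Rightarrow> 'w \<Rightarrow> real^'n^'m"
    and Y :: "nat \<Rightarrow> 'w \<Rightarrow> real"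
    and A0 :: "real^'n^'m"
  assumes n_pos: "1 \<le> n"
    and indep: "indep_vars (\<lambda>_. borel \<Otimes>\<^sub>M borel) (\<lambda>i \<omega>. (X i \<omega>, Y i \<omega>)) {1..n}"
    and integrable_Y: "\<And>i. i \<in> {1..n} \<Longrightarrow> integrable P (Y i)"
    and integrable_XX: "\<And>i A B. i \<in> {1..n} \<Longrightarrow>
          integrable P (\<lambda>\<omega>. mat_inner A (X i \<omega>) * mat_inner B (X i \<omega>))"
    and integrable_YX: "\<And>i. i \<in> {1..n} \<Longrightarrow> integrable P (\<lambda>\<omega>. Y i \<omega> *\<^sub>R X i \<omega>)"
    and regression: "\<And>i. i \<in> {1..n} \<Longrightarrow>
          AE \<omega> in P. real_cond_exp P (vimage_algebra (space P) (X i) borel) (Y i) \<omega>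
            = trace (transpose (X i \<omega>) ** A0)"

definition L2_inner ::
  "'w measure \<Rightarrow> nat \<Rightarrow> (nat \<Rightarrow> 'w \<Rightarrow> real^'n^'m) \<Rightarrow> real^'n^'m \<Rightarrow> real^'n^'m \<Rightarrow> real" where
  "L2_inner P n X A B =
     1 / real n * (\<Sum>i = 1..n. \<integral>\<omega>. mat_inner A (X i \<omega>) * mat_inner B (X i \<omega>) \<partial>P)"

definition L2_norm ::
  "'w measure \<Rightarrow> nat \<Rightarrow> (nat \<Rightarrow> 'w \<Rightarrow> real^'n^'m) \<Rightarrow> real^'n^'m \<Rightarrow> real" where
  "L2_norm P n X A = sqrt (L2_inner P n X A A)"

definition noise_matrix ::
  "'w measure \<Rightarrow> nat \<Rightarrow> (nat \<Rightarrow> 'w \<Rightarrow> real^'n^'m) \<Rightarrow> (nat \<Rightarrow> 'w \<Rightarrow> real) \<Rightarrow> 'w \<Rightarrow> real^'n^'m" where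
  "noise_matrix P n X Y \<omega> =
     (1 / real n) *\<^sub>R (\<Sum>i = 1..n. Y i \<omega> *\<^sub>R X i \<omega> - (\<integral>\<omega>'. Y i \<omega>' *\<^sub>R X i \<omega>' \<partial>P))"

definition rank_penalized_objective ::
  "'w measure \<Rightarrow> nat \<Rightarrow> (nat \<Rightarrow> 'w \<Rightarrow> real^'n^'m) \<Rightarrow> (nat \<Rightarrow> 'w \<Rightarrow> real) \<Rightarrow> real \<Rightarrow> 'w
     \<Rightarrow> real^'n^'m \<Rightarrow> real" where
  "rank_penalized_objective P n X Y lam \<omega> A =
     (L2_norm P n X A)\<^sup>2 - mat_inner ((2 / real n) *\<^sub>R (\<Sum>i = 1..n. Y i \<omega> *\<^sub>R X i \<omega>)) A
       + lam * real (rank A)"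

text \<open>The minimizer need not be unique; these are all values the estimator may take.\<close>
definition rank_penalized_estimators ::
  "'w measure \<Rightarrow> nat \<Rightarrow> (nat \<Rightarrow> 'w \<Rightarrow> real^'n^'m) \<Rightarrow> (nat \<Rightarrow> 'w \<Rightarrow> real) \<Rightarrow> real \<Rightarrow> 'w
     \<Rightarrow> (real^'n^'m) set" where
  "rank_penalized_estimators P n X Y lam \<omega> =
     {A. is_arg_min (rank_penalized_objective P n X Y lam \<omega>) (\<lambda>_. True) A}"

end

theory Submission
  imports Defs
begin

text \<open>
  Since \<open>Y i\<close> has conditional mean \<open>\<langle>X i, A0\<rangle>\<close>, the penalized criterion is, up to a
  constant, \<open>|A - A0|\<^sup>2 - 2 \<langle>M, A\<rangle> + lam rank A\<close>, where the norm is that of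
  \<open>L\<^sub>2(\<Pi>)\<close> and \<open>M\<close> is the noise matrix. Comparing a minimizer \<open>Ah\<close> with a
  competitor \<open>A\<close> gives
  \<open>|Ah - A0|\<^sup>2 \<le> |A - A0|\<^sup>2 + 2 \<langle>M, Ah - A\<rangle> + lam (rank A - rank Ah)\<close>
  (\<open>rank_penalized_estimator_basic_inequality\<close>).

  The noise term is small because \<open>Ah - A\<close> has rank at most \<open>rank Ah + rank A\<close>: trace duality
  (\<open>inner_le_spectral_norm_rank\<close>) bounds \<open>\<langle>M, B\<rangle>\<close> by the spectral norm of \<open>M\<close> times
  \<open>sqrt (rank B)\<close> times the Frobenius norm of \<open>B\<close>. The Frobenius norm is at most \<open>\<mu>\<close> times
  the \<open>L\<^sub>2(\<Pi>)\<close> norm, and the choice of \<open>lam\<close> absorbs the spectral norm of \<open>M\<close>. Hence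
  \<open>2 \<langle>M, Ah - A\<rangle> \<le> (sqrt lam / \<rho>) sqrt (rank Ah + rank A) |Ah - A|\<close>
  (\<open>noise_inner_le\<close>). The three conclusions follow from this by arithmetic of real numbers:
  \<open>A = A0\<close> gives the rank bound; for general \<open>A\<close> the triangle inequality
  \<open>|Ah - A| \<le> |Ah - A0| + |A - A0|\<close> leads to the two risk bounds.

  Singular values are defined through the eigenspaces of \<open>A\<^sup>T A\<close>. To connect them with the
  Frobenius norm and with the operator bound \<open>|A x| \<le> \<sigma>\<^sub>1(A) |x|\<close>, an orthonormal
  eigenbasis of \<open>A\<^sup>T A\<close> is constructed (\<open>self_adjoint_eigenbasis\<close>); the singular values are
  then the numbers \<open>|A b|\<close> for \<open>b\<close> in this basis, with the correct multiplicities
  (\<open>singular_values_eq_norms_on_basis\<close>).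
\<close>

section \<open>Positive semidefinite quadratic forms\<close>

lemma discriminant_nonpos:
  fixes a b c :: real
  assumes nonneg: "\<And>t. 0 \<le> a + 2 * t * b + t\<^sup>2 * c" and c: "0 \<le> c"
  shows "b\<^sup>2 \<le> a * c"
proof (cases "c = 0")
  case True
  have "b = 0"
  proof (rule ccontr)
    assume b: "b \<noteq> 0"
    have "0 \<le> a + 2 * (- (a + 1) / (2 * b)) * b"
      using nonneg[of "- (a + 1) / (2 * b)"] True by simp
    also have "\<dots> = -1"
      using b by (simp add: field_simps)
    finally show False by simp
  qed
  then show ?thesis using True by simp
next
  case False
  then have "0 < c" using c by simp
  moreover have "0 \<le> a + 2 * (- b / c) * b + (- b / c)\<^sup>2 * c" by (rule nonneg)
  ultimately show ?thesis
    by (simp add: field_simps power2_eq_square)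
qed

section \<open>Orthonormal eigenbases of self-adjoint maps\<close>

definition orthonormal_basis_of :: "'a::euclidean_space set \<Rightarrow> 'a set \<Rightarrow> bool" where
  "orthonormal_basis_of U E \<longleftrightarrow>
     E \<subseteq> U \<and> pairwise orthogonal E \<and> (\<forall>b\<in>E. norm b = 1) \<and> span E = U"

lemma orthonormal_basis_of_independent:
  assumes "orthonormal_basis_of U E"
  shows "independent E"
  using assms pairwise_orthogonal_independent unfolding orthonormal_basis_of_def
  by (metis norm_zero zero_neq_one)

lemma orthonormal_basis_of_finite: "orthonormal_basis_of U E \<Longrightarrow> finite E"
  using orthonormal_basis_of_independent independent_imp_finite by blast

lemma orthonormal_basis_of_card: "orthonormal_basis_of U E \<Longrightarrow> card E = dim U"
  using orthonormal_basis_of_independent[of U E]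
  by (metis dim_eq_card_independent dim_span orthonormal_basis_of_def)

lemma inner_orthonormal_basis_expand:
  assumes E: "orthonormal_basis_of U E" and x: "x \<in> U"
  shows "x \<bullet> y = (\<Sum>b\<in>E. (x \<bullet> b) * (y \<bullet> b))"
proof -
  have "x = (\<Sum>b\<in>E. (x \<bullet> b) *\<^sub>R b)"
    using orthonormal_basis_expand[of E x] E x orthonormal_basis_of_finite[OF E]
    by (simp add: orthonormal_basis_of_def)
  then have "x \<bullet> y = (\<Sum>b\<in>E. (x \<bullet> b) *\<^sub>R b) \<bullet> y" by (rule arg_cong)
  also have "\<dots> = (\<Sum>b\<in>E. (x \<bullet> b) * (y \<bullet> b))"
    by (simp add: inner_sum_left inner_commute[of y])
  finally show ?thesis .
qed

text \<open>
  A maximiser \<open>v\<close> of the Rayleigh quotient works: the form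
  \<open>l |x|\<^sup>2 - x \<bullet> f x\<close> with \<open>l = v \<bullet> f v\<close> is positive semidefinite and vanishes at
  \<open>v\<close>, so by Cauchy-Schwarz \<open>v\<close> lies in its kernel, which says \<open>f v = l v\<close>.
\<close>
lemma self_adjoint_has_unit_eigenvector:
  fixes f :: "'a::euclidean_space \<Rightarrow> 'a"
  assumes f: "linear f" and adj: "\<And>x y. f x \<bullet> y = x \<bullet> f y"
    and U: "subspace U" "f ` U \<subseteq> U" "U \<noteq> {0}"
  obtains v where "v \<in> U" "norm v = 1" "f v = (v \<bullet> f v) *\<^sub>R v"
proof -
  have "compact (U \<inter> sphere 0 1)"
    using closed_subspace[OF U(1)] by (simp add: closed_Int_compact)
  moreover obtain u where u: "u \<in> U" "u \<noteq> 0"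
    using U(1,3) subspace_0 by blast
  then have "u /\<^sub>R norm u \<in> U \<inter> sphere 0 1"
    using U(1) by (simp add: subspace_scale)
  then have "U \<inter> sphere 0 1 \<noteq> {}" by blast
  moreover have "continuous_on (U \<inter> sphere 0 1) (\<lambda>x. x \<bullet> f x)"
    using linear_continuous_on[of f] f
    by (intro continuous_on_inner continuous_on_id) (simp add: linear_conv_bounded_linear)
  ultimately obtain v where v: "v \<in> U \<inter> sphere 0 1"
    and max: "\<And>x. x \<in> U \<inter> sphere 0 1 \<Longrightarrow> x \<bullet> f x \<le> v \<bullet> f v"
    using continuous_attains_sup[of "U \<inter> sphere 0 1" "\<lambda>x. x \<bullet> f x"] by blast
  define l where "l = v \<bullet> f v"
  have psd: "0 \<le> l * (x \<bullet> x) - x \<bullet> f x" if "x \<in> U" for x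
  proof (cases "x = 0")
    case True
    then show ?thesis by simp
  next
    case False
    have "x /\<^sub>R norm x \<in> U \<inter> sphere 0 1"
      using that U(1) False by (simp add: subspace_scale)
    then have "(x /\<^sub>R norm x) \<bullet> f (x /\<^sub>R norm x) \<le> l"
      unfolding l_def by (rule max)
    then have "(x \<bullet> f x) / (norm x)\<^sup>2 \<le> l"
      by (simp add: linear_cmul[OF f] divide_inverse power2_eq_square mult.commute mult.left_commute)
    then show ?thesis
      using False by (simp add: divide_le_eq power2_norm_eq_inner)
  qed
  define w where "w = l *\<^sub>R v - f v"
  have w: "w \<in> U"
    using v U by (auto simp: w_def intro!: subspace_diff subspace_scale)
  have v1: "v \<bullet> v = 1"
    using v by (simp add: power2_norm_eq_inner[symmetric])
  have "w \<bullet> w = l * (v \<bullet> w) - f v \<bullet> w"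
    by (subst (1) w_def) (simp add: inner_diff_left)
  then have fw: "f v \<bullet> w = l * (v \<bullet> w) - w \<bullet> w" by simp
  have "(w \<bullet> w)\<^sup>2 \<le> (l * (v \<bullet> v) - v \<bullet> f v) * (l * (w \<bullet> w) - w \<bullet> f w)"
  proof (rule discriminant_nonpos)
    fix t :: real
    have "v + t *\<^sub>R w \<in> U"
      using v w U(1) by (simp add: subspace_add subspace_scale)
    from psd[OF this]
    have "0 \<le> l * (v \<bullet> v + 2 * t * (v \<bullet> w) + t\<^sup>2 * (w \<bullet> w))
        - (v \<bullet> f v + 2 * t * (f v \<bullet> w) + t\<^sup>2 * (w \<bullet> f w))"
      using adj[of w v]
      by (simp add: linear_add[OF f] linear_cmul[OF f] inner_add_left inner_add_right adj
          inner_commute algebra_simps power2_eq_square)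
    then show "0 \<le> (l * (v \<bullet> v) - v \<bullet> f v) + 2 * t * (w \<bullet> w)
        + t\<^sup>2 * (l * (w \<bullet> w) - w \<bullet> f w)"
      unfolding fw by (simp add: algebra_simps)
  qed (rule psd[OF w])
  then have "w = 0"
    using v1 by (simp add: l_def)
  with v show ?thesis
    by (intro that[of v]) (auto simp: w_def l_def)
qed

text \<open>
  The spectral theorem, by splitting off one eigenvector at a time: the part of an invariant
  subspace that is orthogonal to an eigenvector is again invariant.
\<close>
lemma self_adjoint_eigenbasis:
  fixes f :: "'a::euclidean_space \<Rightarrow> 'a"
  assumes f: "linear f" and adj: "\<And>x y. f x \<bullet> y = x \<bullet> f y"
    and "subspace U" "f ` U \<subseteq> U"
  shows "\<exists>E. orthonormal_basis_of U E \<and> (\<forall>b\<in>E. f b = (b \<bullet> f b) *\<^sub>R b)"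
  using assms(3,4)
proof (induction "dim U" arbitrary: U rule: less_induct)
  case less
  show ?case
  proof (cases "U = {0}")
    case True
    then have "orthonormal_basis_of U {}"
      by (simp add: orthonormal_basis_of_def)
    then show ?thesis by blast
  next
    case False
    from self_adjoint_has_unit_eigenvector[OF f adj less.prems False] obtain v where
      v: "v \<in> U" "norm v = 1" "f v = (v \<bullet> f v) *\<^sub>R v" by metis
    have vv: "v \<bullet> v = 1"
      using v(2) by (simp add: power2_norm_eq_inner[symmetric])
    define W where "W = U \<inter> {x. v \<bullet> x = 0}"
    have W: "subspace W"
      unfolding W_def using less.prems(1) subspace_hyperplane by (rule subspace_inter)
    have "f ` W \<subseteq> W"
    proof
      fix y assume "y \<in> f ` W"
      then obtain x where x: "x \<in> U" "v \<bullet> x = 0" "y = f x" by (auto simp: W_def)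
      have "v \<bullet> f x = f v \<bullet> x" by (simp add: adj)
      also have "\<dots> = (v \<bullet> f v) * (v \<bullet> x)" using v(3) by (metis inner_scaleR_left)
      finally show "y \<in> W" using x less.prems(2) by (auto simp: W_def)
    qed
    moreover have "dim W < dim U"
    proof (rule dim_psubset)
      have "v \<notin> W" by (simp add: W_def vv)
      then have "W \<subset> U" using v(1) W_def by blast
      then show "span W \<subset> span U"
        using W less.prems(1) by (metis span_eq_iff)
    qed
    ultimately obtain E where E: "orthonormal_basis_of W E"
      and eig: "\<And>b. b \<in> E \<Longrightarrow> f b = (b \<bullet> f b) *\<^sub>R b"
      using less.hyps[of W] W by blast
    have "orthonormal_basis_of U (insert v E)"
      unfolding orthonormal_basis_of_def
    proof (intro conjI)
      show sub: "insert v E \<subseteq> U"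
        using E v(1) by (auto simp: orthonormal_basis_of_def W_def)
      show "pairwise orthogonal (insert v E)"
        using E unfolding orthonormal_basis_of_def pairwise_insert
        by (auto simp: W_def orthogonal_def inner_commute)
      show "\<forall>b\<in>insert v E. norm b = 1"
        using E v(2) by (auto simp: orthonormal_basis_of_def)
      show "span (insert v E) = U"
      proof
        show "span (insert v E) \<subseteq> U"
          using sub less.prems(1) by (rule span_minimal)
        show "U \<subseteq> span (insert v E)"
        proof
          fix x assume x: "x \<in> U"
          have "x - (v \<bullet> x) *\<^sub>R v \<in> W"
            using x v(1) less.prems(1) vv
            by (auto simp: W_def inner_diff_right intro!: subspace_diff subspace_scale)
          then have "x - (v \<bullet> x) *\<^sub>R v \<in> span E"
            using E by (simp add: orthonormal_basis_of_def)
          then show "x \<in> span (insert v E)"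
            using span_breakdown_eq by blast
        qed
      qed
    qed
    then show ?thesis using eig v(3) by blast
  qed
qed

section \<open>Singular values\<close>

lemma mat_inner_eq_inner: "mat_inner A B = A \<bullet> (B :: real^'n^'m)"
  unfolding mat_inner_def trace_def matrix_matrix_mult_def transpose_def inner_vec_def
  by (simp add: sum.swap[of _ "UNIV :: 'n set" "UNIV :: 'm set"])

lemma gram_matrix_inner:
  fixes A :: "real^'n^'m"
  shows "((transpose A ** A) *v x) \<bullet> y = (A *v x) \<bullet> (A *v y)"
    "x \<bullet> ((transpose A ** A) *v y) = (A *v x) \<bullet> (A *v y)"
  by (metis dot_lmul_matrix matrix_vector_mul_assoc vector_transpose_matrix transpose_transpose
      inner_commute)+

text \<open>
  The right singular vectors. The eigenvalue belonging to \<open>b\<close> is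
  \<open>b \<bullet> A\<^sup>T A b = |A b|\<^sup>2\<close>, so \<open>|A b|\<close> is the singular value.
\<close>
lemma right_singular_basis:
  fixes A :: "real^'n^'m"
  obtains E where "orthonormal_basis_of UNIV E"
    "\<And>b. b \<in> E \<Longrightarrow> (transpose A ** A) *v b = (norm (A *v b))\<^sup>2 *\<^sub>R b"
proof -
  obtain E where "orthonormal_basis_of UNIV E"
    "\<forall>b\<in>E. (transpose A ** A) *v b = (b \<bullet> ((transpose A ** A) *v b)) *\<^sub>R b"
    using self_adjoint_eigenbasis[of "\<lambda>x. (transpose A ** A) *v x" UNIV]
    by (auto simp: gram_matrix_inner)
  then show ?thesis
    by (intro that[of E]) (simp_all add: gram_matrix_inner power2_norm_eq_inner)
qed

text \<open>
  Eigenvectors of \<open>A\<^sup>T A\<close> for different eigenvalues are orthogonal. Hence each eigenspace is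
  spanned by the basis vectors that it contains, and its dimension counts them.
\<close>
lemma singular_values_eq_norms_on_basis:
  fixes A :: "real^'n^'m"
  assumes E: "orthonormal_basis_of UNIV E"
    and eig: "\<And>b. b \<in> E \<Longrightarrow> (transpose A ** A) *v b = (norm (A *v b))\<^sup>2 *\<^sub>R b"
  shows "mset (singular_values A) = image_mset (\<lambda>b. norm (A *v b)) (mset_set E)"
proof -
  define G where "G = transpose A ** A"
  define V where "V s = {v. G *v v = s\<^sup>2 *\<^sub>R v}" for s :: real
  define S where "S = {s. 0 \<le> s \<and> (\<exists>v. v \<noteq> 0 \<and> v \<in> V s)}"
  let ?E = "\<lambda>s. {b\<in>E. norm (A *v b) = s}"
  have fin: "finite E" by (rule orthonormal_basis_of_finite[OF E])
  have b0: "b \<noteq> 0" if "b \<in> E" for b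
    using E that by (auto simp: orthonormal_basis_of_def)
  have ortho: "v \<bullet> b = 0" if "v \<in> V s" "0 \<le> s" "b \<in> E" "norm (A *v b) \<noteq> s" for v s b
  proof -
    have "s\<^sup>2 * (v \<bullet> b) = (G *v v) \<bullet> b" using that(1) by (simp add: V_def)
    also have "\<dots> = v \<bullet> (G *v b)" by (simp add: G_def gram_matrix_inner)
    also have "\<dots> = (norm (A *v b))\<^sup>2 * (v \<bullet> b)" using eig[OF that(3)] by (simp add: G_def)
    finally show ?thesis
      using that(2,4) by (auto simp: power2_eq_iff_nonneg)
  qed
  have span: "v \<in> span (?E s)" if v: "v \<in> V s" "0 \<le> s" for v s
  proof -
    have "v = (\<Sum>b\<in>E. (v \<bullet> b) *\<^sub>R b)"
      using orthonormal_basis_expand[of E v] E fin by (simp add: orthonormal_basis_of_def)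
    also have "\<dots> = (\<Sum>b\<in>?E s. (v \<bullet> b) *\<^sub>R b)"
      using fin ortho[OF v] by (intro sum.mono_neutral_right) auto
    also have "\<dots> \<in> span (?E s)"
      by (intro span_sum span_scale span_base)
    finally show ?thesis .
  qed
  have dim: "dim (V s) = card (?E s)" if "0 \<le> s" for s
  proof (rule dim_unique)
    show "?E s \<subseteq> V s" using eig by (auto simp: V_def G_def)
    show "V s \<subseteq> span (?E s)" using span that by blast
    show "independent (?E s)"
      using orthonormal_basis_of_independent[OF E] by (rule independent_mono) auto
  qed simp
  have S: "S = (\<lambda>b. norm (A *v b)) ` E"
  proof
    show "S \<subseteq> (\<lambda>b. norm (A *v b)) ` E"
    proof
      fix s assume "s \<in> S"
      then obtain v where v: "0 \<le> s" "v \<noteq> 0" "v \<in> V s" by (auto simp: S_def)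
      then have "?E s \<noteq> {}" using span[of v s] by fastforce
      then show "s \<in> (\<lambda>b. norm (A *v b)) ` E" by blast
    qed
    show "(\<lambda>b. norm (A *v b)) ` E \<subseteq> S"
      using eig b0 by (auto simp: S_def V_def G_def)
  qed
  have "mset (singular_values A) = (\<Sum>s\<in>S. replicate_mset (dim (V s)) s)"
    by (simp add: singular_values_def S_def V_def G_def)
  also have "\<dots> = (\<Sum>s\<in>S. replicate_mset (card (?E s)) s)"
    by (intro sum.cong) (auto simp: dim S_def)
  also have "\<dots> = image_mset (\<lambda>b. norm (A *v b)) (mset_set E)"
  proof (rule multiset_eqI)
    fix t
    have "count (\<Sum>s\<in>S. replicate_mset (card (?E s)) s) t
        = (\<Sum>s\<in>S. if s = t then card (?E t) else 0)"
      unfolding count_sum by (intro sum.cong) auto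
    also have "\<dots> = (if t \<in> S then card (?E t) else 0)"
      using fin S by simp
    also have "\<dots> = card (?E t)"
    proof (cases "t \<in> S")
      case False
      then have "?E t = {}" using S by auto
      then have "card (?E t) = 0" by (simp only: card.empty)
      then show ?thesis using False by (simp only: if_False)
    qed simp
    also have "\<dots> = count (image_mset (\<lambda>b. norm (A *v b)) (mset_set E)) t"
      using fin by (simp add: count_image_mset vimage_def Int_def conj_commute)
    finally show "count (\<Sum>s\<in>S. replicate_mset (card (?E s)) s) t
        = count (image_mset (\<lambda>b. norm (A *v b)) (mset_set E)) t" .
  qed
  finally show ?thesis .
qed

text \<open>
  Expanding the rows of \<open>A\<close> in an orthonormal basis turns the trace inner product into a sum over
  basis vectors. With a basis of the row space of \<open>A\<close> the number of summands is the rank of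
  \<open>A\<close>.
\<close>
lemma inner_eq_sum_over_row_basis:
  fixes A B :: "real^'n^'m"
  assumes E: "orthonormal_basis_of U E" and rows: "rows A \<subseteq> U"
  shows "A \<bullet> B = (\<Sum>b\<in>E. (A *v b) \<bullet> (B *v b))"
proof -
  have "A $ i \<in> U" for i
    using rows by (auto simp: rows_def row_def vec_nth_inverse)
  then have "A \<bullet> B = (\<Sum>i\<in>UNIV. \<Sum>b\<in>E. (A $ i \<bullet> b) * (B $ i \<bullet> b))"
    unfolding inner_vec_def[of A B] by (intro sum.cong inner_orthonormal_basis_expand[OF E]) auto
  also have "\<dots> = (\<Sum>b\<in>E. \<Sum>i\<in>UNIV. (A $ i \<bullet> b) * (B $ i \<bullet> b))"
    by (rule sum.swap)
  also have "\<dots> = (\<Sum>b\<in>E. (A *v b) \<bullet> (B *v b))"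
    by (simp add: inner_vec_def[of "A *v _" "B *v _"] matrix_vector_mul_component)
  finally show ?thesis .
qed

lemma schatten_norm_2_eq_norm: "schatten_norm 2 A = norm (A :: real^'n^'m)"
proof -
  obtain E where E: "orthonormal_basis_of UNIV E"
    "\<And>b. b \<in> E \<Longrightarrow> (transpose A ** A) *v b = (norm (A *v b))\<^sup>2 *\<^sub>R b"
    using right_singular_basis[of A] by metis
  have mset: "mset (singular_values A) = image_mset (\<lambda>b. norm (A *v b)) (mset_set E)"
    using E by (rule singular_values_eq_norms_on_basis)
  have "(\<Sum>s\<leftarrow>singular_values A. s powr 2)
      = (\<Sum>s\<in>#mset (singular_values A). s powr 2)"
    by (metis mset_map sum_mset_sum_list)
  also have "\<dots> = (\<Sum>b\<in>E. norm (A *v b) powr 2)"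
    by (simp only: mset multiset.map_comp o_def sum_unfold_sum_mset)
  also have "\<dots> = (\<Sum>b\<in>E. (A *v b) \<bullet> (A *v b))"
    by (simp add: powr_numeral power2_norm_eq_inner)
  also have "\<dots> = A \<bullet> A"
    by (rule inner_eq_sum_over_row_basis[OF E(1), symmetric]) simp
  finally have *: "(\<Sum>s\<leftarrow>singular_values A. s powr 2) = A \<bullet> A" .
  show ?thesis
    unfolding schatten_norm_def * norm_eq_sqrt_inner by (simp add: powr_half_sqrt)
qed

lemma norm_mult_le_spectral_norm:
  fixes A :: "real^'n^'m"
  shows "norm (A *v x) \<le> spectral_norm A * norm x" and "0 \<le> spectral_norm A"
proof -
  obtain E where E: "orthonormal_basis_of UNIV E"
    "\<And>b. b \<in> E \<Longrightarrow> (transpose A ** A) *v b = (norm (A *v b))\<^sup>2 *\<^sub>R b"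
    using right_singular_basis[of A] by metis
  have "mset (singular_values A) = image_mset (\<lambda>b. norm (A *v b)) (mset_set E)"
    using E by (rule singular_values_eq_norms_on_basis)
  then have set: "set (singular_values A) = (\<lambda>b. norm (A *v b)) ` E"
    using orthonormal_basis_of_finite[OF E(1)]
    by (metis finite_set_mset_mset_set set_image_mset set_mset_mset)
  have "sorted_wrt (\<ge>) (singular_values A)"
    by (simp add: singular_values_def sorted_wrt_rev)
  then have le: "s \<le> spectral_norm A" if "s \<in> set (singular_values A)" for s
    using that unfolding spectral_norm_def by (cases "singular_values A") auto
  have "E \<noteq> {}"
    using orthonormal_basis_of_card[OF E(1)] by auto
  then show nonneg: "0 \<le> spectral_norm A"
    using le set norm_ge_zero order_trans by blast
  have "(norm (A *v x))\<^sup>2 = ((transpose A ** A) *v x) \<bullet> x"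
    by (simp add: gram_matrix_inner power2_norm_eq_inner)
  also have "\<dots> = (\<Sum>b\<in>E. (((transpose A ** A) *v x) \<bullet> b) * (x \<bullet> b))"
    by (rule inner_orthonormal_basis_expand[OF E(1)]) simp
  also have "\<dots> = (\<Sum>b\<in>E. (norm (A *v b))\<^sup>2 * (x \<bullet> b)\<^sup>2)"
  proof (rule sum.cong)
    fix b assume "b \<in> E"
    have "((transpose A ** A) *v x) \<bullet> b = x \<bullet> ((transpose A ** A) *v b)"
      by (simp add: gram_matrix_inner)
    also have "\<dots> = (norm (A *v b))\<^sup>2 * (x \<bullet> b)"
      using E(2)[OF \<open>b \<in> E\<close>] by simp
    finally show "(((transpose A ** A) *v x) \<bullet> b) * (x \<bullet> b) = (norm (A *v b))\<^sup>2 * (x \<bullet> b)\<^sup>2"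
      by (simp add: power2_eq_square)
  qed simp
  also have "\<dots> \<le> (\<Sum>b\<in>E. (spectral_norm A)\<^sup>2 * (x \<bullet> b)\<^sup>2)"
    using le set by (intro sum_mono mult_right_mono power_mono) auto
  also have "\<dots> = (spectral_norm A)\<^sup>2 * (x \<bullet> x)"
    using inner_orthonormal_basis_expand[OF E(1), of x x]
    by (simp add: sum_distrib_left power2_eq_square)
  also have "\<dots> = (spectral_norm A * norm x)\<^sup>2"
    by (simp add: power_mult_distrib power2_norm_eq_inner)
  finally show "norm (A *v x) \<le> spectral_norm A * norm x"
    by (rule power2_le_imp_le) (simp add: nonneg)
qed

text \<open>
  This combines the duality of the spectral and the nuclear norm with the bound of the nuclear norm
  by \<open>sqrt (rank B)\<close> times the Frobenius norm. Over an orthonormal basis of the row space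
  of \<open>B\<close> the inner product is a sum of \<open>rank B\<close> terms, each at most
  \<open>spectral_norm M * |B b|\<close>, and the squares \<open>|B b|\<^sup>2\<close> add up to the squared
  Frobenius norm.
\<close>
lemma inner_le_spectral_norm_rank:
  fixes M B :: "real^'n^'m"
  shows "M \<bullet> B \<le> spectral_norm M * (sqrt (real (rank B)) * norm B)"
proof -
  \<comment> \<open>Every orthonormal basis is an eigenbasis of the identity.\<close>
  obtain E where E: "orthonormal_basis_of (span (rows B)) E"
    using self_adjoint_eigenbasis[of id "span (rows B)"]
    by (auto simp: linear_id)
  note sum_eq = inner_eq_sum_over_row_basis[OF E span_superset]
  have card: "card E = rank B"
    using orthonormal_basis_of_card[OF E] by (simp add: row_rank_def)
  have "M \<bullet> B = (\<Sum>b\<in>E. (B *v b) \<bullet> (M *v b))"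
    using sum_eq[of M] by (simp add: inner_commute)
  also have "\<dots> \<le> (\<Sum>b\<in>E. spectral_norm M * norm (B *v b))"
  proof (rule sum_mono)
    fix b assume "b \<in> E"
    then have "norm b = 1" using E by (simp add: orthonormal_basis_of_def)
    then have "norm (M *v b) \<le> spectral_norm M"
      using norm_mult_le_spectral_norm(1)[of M b] by simp
    then have "norm (B *v b) * norm (M *v b) \<le> norm (B *v b) * spectral_norm M"
      by (rule mult_left_mono) simp
    then show "(B *v b) \<bullet> (M *v b) \<le> spectral_norm M * norm (B *v b)"
      using norm_cauchy_schwarz[of "B *v b" "M *v b"] by (simp add: mult.commute)
  qed
  also have "\<dots> = spectral_norm M * (\<Sum>b\<in>E. 1 * norm (B *v b))"
    by (simp add: sum_distrib_left)
  also have "\<dots> \<le> spectral_norm M * (sqrt (real (rank B)) * norm B)"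
  proof (rule mult_left_mono)
    have "(\<Sum>b\<in>E. 1 * norm (B *v b))\<^sup>2 \<le> (\<Sum>b\<in>E. 1\<^sup>2) * (\<Sum>b\<in>E. (norm (B *v b))\<^sup>2)"
      by (rule Cauchy_Schwarz_ineq_sum)
    also have "\<dots> = (sqrt (real (rank B)) * norm B)\<^sup>2"
      using sum_eq[of B] card by (simp add: power_mult_distrib power2_norm_eq_inner)
    finally show "(\<Sum>b\<in>E. 1 * norm (B *v b)) \<le> sqrt (real (rank B)) * norm B"
      by (rule power2_le_imp_le) simp
  qed (rule norm_mult_le_spectral_norm(2))
  finally show ?thesis .
qed

lemma rank_diff_le: "rank (A - B) \<le> rank A + rank (B :: real^'n^'m)"
proof -
  let ?R = "\<lambda>A :: real^'n^'m. range (\<lambda>x. A *v x)"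
  have "?R (A - B) \<subseteq> {x + y |x y. x \<in> ?R A \<and> y \<in> ?R B}"
  proof
    fix z assume "z \<in> ?R (A - B)"
    then obtain x where "z = A *v x + B *v (- x)"
      by (auto simp: matrix_vector_mult_diff_rdistrib vec.neg)
    then show "z \<in> {x + y |x y. x \<in> ?R A \<and> y \<in> ?R B}" by blast
  qed
  then have "dim (?R (A - B)) \<le> dim {x + y |x y. x \<in> ?R A \<and> y \<in> ?R B}"
    by (rule dim_subset)
  also have "\<dots> \<le> dim (?R A) + dim (?R B)"
    using dim_sums_Int[of "?R A" "?R B"]
    by (simp add: linear_subspace_image)
  finally show ?thesis by (simp add: rank_dim_range)
qed

section \<open>The trace regression model\<close>

context trace_regression
begin

lemma integrable_inner_XX:
  assumes "i \<in> {1..n}"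
  shows "integrable P (\<lambda>\<omega>. (A \<bullet> X i \<omega>) * (B \<bullet> X i \<omega>))"
  using integrable_XX[OF assms, of A B] by (simp add: mat_inner_eq_inner)

lemma L2_inner_add_scaleR:
  "L2_inner P n X (A + t *\<^sub>R B) (A + t *\<^sub>R B)
     = L2_inner P n X A A + 2 * t * L2_inner P n X A B + t\<^sup>2 * L2_inner P n X B B"
proof -
  let ?I = "\<lambda>A B i. \<integral>\<omega>. (A \<bullet> X i \<omega>) * (B \<bullet> X i \<omega>) \<partial>P"
  have "?I (A + t *\<^sub>R B) (A + t *\<^sub>R B) i = ?I A A i + 2 * t * ?I A B i + t\<^sup>2 * ?I B B i"
    if "i \<in> {1..n}" for i
  proof -
    have "?I (A + t *\<^sub>R B) (A + t *\<^sub>R B) i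
        = (\<integral>\<omega>. (A \<bullet> X i \<omega>) * (A \<bullet> X i \<omega>) + (2 * t) * ((A \<bullet> X i \<omega>) * (B \<bullet> X i \<omega>))
            + t\<^sup>2 * ((B \<bullet> X i \<omega>) * (B \<bullet> X i \<omega>)) \<partial>P)"
      by (simp add: inner_add_left algebra_simps power2_eq_square)
    also have "\<dots> = ?I A A i + 2 * t * ?I A B i + t\<^sup>2 * ?I B B i"
      using integrable_inner_XX[OF that] by simp
    finally show ?thesis .
  qed
  then have "(\<Sum>i = 1..n. ?I (A + t *\<^sub>R B) (A + t *\<^sub>R B) i)
      = (\<Sum>i = 1..n. ?I A A i) + 2 * t * (\<Sum>i = 1..n. ?I A B i) + t\<^sup>2 * (\<Sum>i = 1..n. ?I B B i)"
    by (simp add: sum.distrib sum_distrib_left)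
  then show ?thesis
    by (simp add: L2_inner_def mat_inner_eq_inner algebra_simps add_divide_distrib)
qed

lemma L2_inner_nonneg: "0 \<le> L2_inner P n X A A"
  unfolding L2_inner_def by (intro mult_nonneg_nonneg sum_nonneg integral_nonneg_AE) auto

lemma L2_norm_nonneg: "0 \<le> L2_norm P n X A"
  by (simp add: L2_norm_def L2_inner_nonneg)

lemma L2_norm_power2: "(L2_norm P n X A)\<^sup>2 = L2_inner P n X A A"
  by (simp add: L2_norm_def L2_inner_nonneg)

lemma L2_norm_diff_power2:
  "(L2_norm P n X (A - B))\<^sup>2
     = (L2_norm P n X A)\<^sup>2 - 2 * L2_inner P n X A B + (L2_norm P n X B)\<^sup>2"
  using L2_inner_add_scaleR[of A "-1" B] by (simp add: L2_norm_power2)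

lemma L2_inner_le_norms:
  "\<bar>L2_inner P n X A B\<bar> \<le> L2_norm P n X A * L2_norm P n X B"
proof -
  have "(L2_inner P n X A B)\<^sup>2 \<le> L2_inner P n X A A * L2_inner P n X B B"
    using L2_inner_nonneg[of "A + _ *\<^sub>R B"] L2_inner_nonneg[of B]
    by (intro discriminant_nonpos) (simp_all add: L2_inner_add_scaleR)
  also have "\<dots> = (L2_norm P n X A * L2_norm P n X B)\<^sup>2"
    by (simp add: power_mult_distrib L2_norm_power2)
  finally have "\<bar>L2_inner P n X A B\<bar>\<^sup>2 \<le> (L2_norm P n X A * L2_norm P n X B)\<^sup>2" by simp
  then show ?thesis
    by (rule power2_le_imp_le) (simp add: L2_norm_nonneg)
qed

lemma L2_norm_triangle:
  "L2_norm P n X (A - B) \<le> L2_norm P n X A + L2_norm P n X B"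
proof (rule power2_le_imp_le)
  show "(L2_norm P n X (A - B))\<^sup>2 \<le> (L2_norm P n X A + L2_norm P n X B)\<^sup>2"
    using L2_inner_le_norms[of A B] unfolding L2_norm_diff_power2 power2_sum by linarith
qed (simp add: L2_norm_nonneg)

lemma measurable_X:
  assumes "i \<in> {1..n}"
  shows "X i \<in> borel_measurable P"
proof -
  have "(\<lambda>\<omega>. (X i \<omega>, Y i \<omega>)) \<in> measurable P (borel \<Otimes>\<^sub>M borel)"
    using indep assms by (simp add: indep_vars_def)
  from measurable_compose[OF this measurable_fst] show ?thesis by simp
qed

text \<open>
  Conditioning on \<open>X i\<close> replaces \<open>Y i\<close> by its regression function, so the
  expectation of \<open>Y i X i\<close> represents the functional \<open>A \<mapsto> E \<langle>A0, X i\<rangle>\<langle>A, X i\<rangle>\<close>.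
\<close>
lemma expectation_YX_inner:
  assumes i: "i \<in> {1..n}"
  shows "(\<integral>\<omega>. Y i \<omega> *\<^sub>R X i \<omega> \<partial>P) \<bullet> A = (\<integral>\<omega>. (A0 \<bullet> X i \<omega>) * (A \<bullet> X i \<omega>) \<partial>P)"
proof -
  let ?F = "vimage_algebra (space P) (X i) borel"
  have sub: "subalgebra P ?F"
    using measurable_X[OF i] unfolding subalgebra_def
    by (auto simp: sets_vimage_algebra2 measurable_def)
  interpret F: finite_measure_subalgebra P ?F
    by unfold_locales (rule sub)
  have X: "X i \<in> borel_measurable ?F"
    by (rule measurable_vimage_algebra1) simp
  have AX: "(\<lambda>\<omega>. A \<bullet> X i \<omega>) \<in> borel_measurable ?F"
    using X by measurable
  have prod: "integrable P (\<lambda>\<omega>. (A \<bullet> X i \<omega>) * Y i \<omega>)"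
    using integrable_inner_left[OF integrable_YX[OF i], of A]
    by (simp add: inner_commute mult.commute)
  have "(\<integral>\<omega>. Y i \<omega> *\<^sub>R X i \<omega> \<partial>P) \<bullet> A = (\<integral>\<omega>. (A \<bullet> X i \<omega>) * Y i \<omega> \<partial>P)"
    using integral_inner_left[of A P "\<lambda>\<omega>. Y i \<omega> *\<^sub>R X i \<omega>"] integrable_YX[OF i]
    by (simp add: inner_commute mult.commute)
  also have "\<dots> = (\<integral>\<omega>. (A \<bullet> X i \<omega>) * real_cond_exp P ?F (Y i) \<omega> \<partial>P)"
    using F.real_cond_exp_intg(2)[OF prod AX] integrable_Y[OF i] by simp
  also have "\<dots> = (\<integral>\<omega>. (A0 \<bullet> X i \<omega>) * (A \<bullet> X i \<omega>) \<partial>P)"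
  proof (rule integral_cong_AE)
    show "AE \<omega> in P. (A \<bullet> X i \<omega>) * real_cond_exp P ?F (Y i) \<omega> = (A0 \<bullet> X i \<omega>) * (A \<bullet> X i \<omega>)"
      using regression[OF i]
      by eventually_elim (simp add: mat_inner_def[symmetric] mat_inner_eq_inner inner_commute)
    show "(\<lambda>\<omega>. (A \<bullet> X i \<omega>) * real_cond_exp P ?F (Y i) \<omega>) \<in> borel_measurable P"
      using measurable_X[OF i] by measurable
  qed (use integrable_inner_XX[OF i] in blast)
  finally show ?thesis .
qed

lemma noise_matrix_inner:
  "((2 / real n) *\<^sub>R (\<Sum>i = 1..n. Y i \<omega> *\<^sub>R X i \<omega>)) \<bullet> A
     = 2 * (noise_matrix P n X Y \<omega> \<bullet> A) + 2 * L2_inner P n X A A0"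
proof -
  have "(\<Sum>i = 1..n. (\<integral>\<omega>'. Y i \<omega>' *\<^sub>R X i \<omega>' \<partial>P) \<bullet> A)
      = (\<Sum>i = 1..n. \<integral>\<omega>'. (A \<bullet> X i \<omega>') * (A0 \<bullet> X i \<omega>') \<partial>P)"
    by (intro sum.cong) (simp_all add: expectation_YX_inner mult.commute)
  then show ?thesis
    by (simp add: noise_matrix_def L2_inner_def mat_inner_eq_inner inner_sum_left
        inner_diff_left sum_subtractf diff_divide_distrib)
qed

text \<open>
  Completing the square: up to a constant, the empirical criterion is the excess risk perturbed by
  the noise.
\<close>
lemma rank_penalized_objective_eq:
  "rank_penalized_objective P n X Y lam \<omega> A
     = (L2_norm P n X (A - A0))\<^sup>2 - (L2_norm P n X A0)\<^sup>2 - 2 * (noise_matrix P n X Y \<omega> \<bullet> A)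
       + lam * real (rank A)"
  unfolding rank_penalized_objective_def mat_inner_eq_inner noise_matrix_inner L2_norm_diff_power2
  by simp

lemma rank_penalized_estimator_basic_inequality:
  assumes "Ah \<in> rank_penalized_estimators P n X Y lam \<omega>"
  shows "(L2_norm P n X (Ah - A0))\<^sup>2
    \<le> (L2_norm P n X (A - A0))\<^sup>2 + 2 * (noise_matrix P n X Y \<omega> \<bullet> (Ah - A))
      + lam * (real (rank A) - real (rank Ah))"
proof -
  have "rank_penalized_objective P n X Y lam \<omega> Ah \<le> rank_penalized_objective P n X Y lam \<omega> A"
    using assms by (auto simp: rank_penalized_estimators_def is_arg_min_def not_less)
  then show ?thesis
    by (simp add: rank_penalized_objective_eq inner_diff_right algebra_simps)
qed

text \<open>
  The noise term is controlled by trace duality, by the comparison of the Frobenius norm with the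
  \<open>L\<^sub>2\<close> norm, and by the size of the penalty; \<open>c\<close> stands for \<open>sqrt lam / \<rho>\<close>.
\<close>
lemma noise_inner_le:
  assumes \<mu>: "0 < \<mu>"
    and compat: "\<And>A :: real^'n^'m. inverse (\<mu>\<^sup>2) * (schatten_norm 2 A)\<^sup>2 \<le> (L2_norm P n X A)\<^sup>2"
    and c: "2 * \<mu> * spectral_norm (noise_matrix P n X Y \<omega>) \<le> c"
  shows "2 * (noise_matrix P n X Y \<omega> \<bullet> (A - B))
    \<le> c * sqrt (real (rank A) + real (rank B)) * L2_norm P n X (A - B)"
proof -
  let ?M = "noise_matrix P n X Y \<omega>" and ?N = "L2_norm P n X (A - B)"
  have "(norm (A - B))\<^sup>2 \<le> (\<mu> * ?N)\<^sup>2"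
    using compat[of "A - B"] \<mu>
    by (simp add: schatten_norm_2_eq_norm power_mult_distrib field_simps)
  then have F: "norm (A - B) \<le> \<mu> * ?N"
    by (rule power2_le_imp_le) (use \<mu> L2_norm_nonneg in auto)
  have R: "sqrt (real (rank (A - B))) \<le> sqrt (real (rank A) + real (rank B))"
    using rank_diff_le[of A B] by (metis of_nat_add of_nat_mono real_sqrt_le_mono)
  have "?M \<bullet> (A - B) \<le> spectral_norm ?M * (sqrt (real (rank (A - B))) * norm (A - B))"
    by (rule inner_le_spectral_norm_rank)
  also have "\<dots> \<le> spectral_norm ?M * (sqrt (real (rank A) + real (rank B)) * (\<mu> * ?N))"
    by (intro mult_left_mono mult_mono R F norm_mult_le_spectral_norm(2)) auto
  finally have "2 * (?M \<bullet> (A - B))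
      \<le> (2 * \<mu> * spectral_norm ?M) * (sqrt (real (rank A) + real (rank B)) * ?N)"
    by (simp add: mult_ac)
  also have "\<dots> \<le> c * (sqrt (real (rank A) + real (rank B)) * ?N)"
    using c L2_norm_nonneg by (intro mult_right_mono) auto
  finally show ?thesis by (simp add: mult.assoc)
qed

end

section \<open>From the basic inequality to the risk bounds\<close>

text \<open>
  Below, \<open>x\<close> and \<open>y\<close> are the \<open>L\<^sub>2\<close> errors of the estimator and
  of a competitor, and \<open>p\<close> and \<open>r\<close> their ranks.
\<close>

text \<open>
  For the competitor with zero error. The noise term is at most \<open>x\<^sup>2\<close> plus
  \<open>lam (p + r) / (4 \<rho>\<^sup>2)\<close>, so the error cancels and an inequality between the ranks remains.
\<close>
lemma competitor_rank_bound:
  fixes x p r lam \<rho> :: real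
  assumes basic: "x\<^sup>2 \<le> sqrt lam / \<rho> * sqrt (p + r) * x + lam * (r - p)"
    and "0 < lam" "1 \<le> \<rho>" "0 \<le> p" "0 \<le> r"
  shows "p \<le> (1 + 2 / (4 * \<rho>\<^sup>2 - 1)) * r"
proof -
  define a where "a = sqrt lam / \<rho> * sqrt (p + r)"
  have a2: "a\<^sup>2 = lam * (p + r) / \<rho>\<^sup>2"
    using assms by (simp add: a_def power_mult_distrib power_divide)
  have "0 \<le> (x - a / 2)\<^sup>2" by simp
  then have "a * x \<le> x\<^sup>2 + a\<^sup>2 / 4"
    by (simp add: power2_eq_square algebra_simps)
  then have "0 \<le> a\<^sup>2 / 4 + lam * (r - p)"
    using basic unfolding a_def by linarith
  also have "\<dots> = lam * ((p + r) / (4 * \<rho>\<^sup>2) + (r - p))"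
    by (simp add: a2 algebra_simps)
  finally have "0 \<le> (p + r) / (4 * \<rho>\<^sup>2) + (r - p)"
    using assms(2) by (simp add: zero_le_mult_iff)
  moreover have \<rho>: "1 \<le> \<rho>\<^sup>2" using assms(3) by simp
  ultimately have "0 \<le> ((p + r) / (4 * \<rho>\<^sup>2) + (r - p)) * (4 * \<rho>\<^sup>2)"
    by (intro mult_nonneg_nonneg) auto
  also have "\<dots> = (p + r) / (4 * \<rho>\<^sup>2) * (4 * \<rho>\<^sup>2) + (r - p) * (4 * \<rho>\<^sup>2)"
    by (rule distrib_right)
  also have "(p + r) / (4 * \<rho>\<^sup>2) * (4 * \<rho>\<^sup>2) = p + r"
    using assms(3) by (intro nonzero_eq_divide_eq[THEN iffD1]) auto
  finally have "p * (4 * \<rho>\<^sup>2 - 1) \<le> (4 * \<rho>\<^sup>2 + 1) * r"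
    by (simp add: algebra_simps)
  then have "p \<le> (4 * \<rho>\<^sup>2 + 1) * r / (4 * \<rho>\<^sup>2 - 1)"
    using \<rho> by (simp add: pos_le_divide_eq)
  also have "\<dots> = (1 + 2 / (4 * \<rho>\<^sup>2 - 1)) * r"
    using \<rho> by (simp add: field_simps)
  finally show ?thesis .
qed

text \<open>
  If the competitor has the smaller rank, the penalties may be dropped and \<open>x + y\<close> cancels; the
  rank bound, which gives at most \<open>5 / 3\<close> times \<open>r0\<close> because \<open>\<rho> \<ge> 1\<close>, then makes
  \<open>r0\<close> the relevant rank. Otherwise \<open>r\<close> dominates both ranks.
\<close>
lemma competitor_norm_bound:
  fixes x y p r r0 lam \<rho> :: real
  assumes basic: "x\<^sup>2 \<le> y\<^sup>2 + sqrt lam / \<rho> * sqrt (p + r) * (x + y) + lam * (r - p)"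
    and rank: "p \<le> (1 + 2 / (4 * \<rho>\<^sup>2 - 1)) * r0"
    and "0 < lam" "1 \<le> \<rho>" "0 \<le> p" "0 \<le> r" "0 \<le> r0" "0 \<le> x" "0 \<le> y"
  shows "x \<le> y + 2 * sqrt (lam * max (1 / \<rho>\<^sup>2 * r0) r)"
proof (cases "x \<le> y")
  case True
  have "0 \<le> sqrt (lam * max (1 / \<rho>\<^sup>2 * r0) r)"
    using assms by (simp add: le_max_iff_disj)
  then show ?thesis using True by linarith
next
  case False
  show ?thesis
  proof (cases "r \<le> p")
    case True
    have "(x - y) * (x + y) = x\<^sup>2 - y\<^sup>2" by (simp add: power2_eq_square algebra_simps)
    also have "\<dots> \<le> sqrt lam / \<rho> * sqrt (p + r) * (x + y)"
      using basic True assms(3) mult_nonneg_nonpos[of lam "r - p"] by linarith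
    finally have "x - y \<le> sqrt lam / \<rho> * sqrt (p + r)"
      using False assms(9) by (intro mult_right_le_imp_le[of "x - y" "x + y"]) auto
    also have "\<dots> \<le> sqrt lam / \<rho> * sqrt (4 * r0)"
    proof -
      have "2 / (4 * \<rho>\<^sup>2 - 1) \<le> 2 / 3"
        using one_le_power[OF assms(4), of 2] by (intro divide_left_mono mult_pos_pos) linarith+
      then have "(1 + 2 / (4 * \<rho>\<^sup>2 - 1)) * r0 \<le> (1 + 2 / 3) * r0"
        using assms(7) by (intro mult_right_mono) auto
      with rank have "p \<le> (1 + 2 / 3) * r0" by (rule order_trans)
      then have "p + r \<le> 4 * r0" using True assms(7) by simp
      then show ?thesis using assms(3,4) by (intro mult_left_mono) auto
    qed
    also have "\<dots> = 2 * sqrt (lam * (1 / \<rho>\<^sup>2 * r0))"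
      using assms(4) by (simp add: real_sqrt_mult real_sqrt_divide)
    also have "\<dots> \<le> 2 * sqrt (lam * max (1 / \<rho>\<^sup>2 * r0) r)"
      using assms(3) by (intro mult_left_mono real_sqrt_le_mono) auto
    finally show ?thesis by simp
  next
    case r: False
    define u where "u = sqrt (lam * r)"
    define w where "w = sqrt (lam * (p + r))"
    have u: "0 \<le> u" "u\<^sup>2 = lam * r" and w: "0 \<le> w" "w\<^sup>2 = lam * p + lam * r"
      using assms by (simp_all add: u_def w_def algebra_simps)
    have "sqrt lam / \<rho> * sqrt (p + r) = w / \<rho>"
      by (simp add: w_def real_sqrt_mult)
    also have "\<dots> \<le> w"
      using w(1) assms(4) by (simp add: divide_le_eq mult_le_cancel_left1)
    finally have "sqrt lam / \<rho> * sqrt (p + r) * (x + y) \<le> w * (x + y)"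
      using assms(8,9) by (intro mult_right_mono) auto
    then have main: "(x - y - w) * (x + y) \<le> lam * (r - p)"
      using basic by (simp add: power2_eq_square algebra_simps)
    have "x - y \<le> 2 * u"
    proof (rule ccontr)
      assume neg: "\<not> x - y \<le> 2 * u"
      have "w\<^sup>2 \<le> (2 * u)\<^sup>2"
        using u w r assms(3,6) mult_left_mono[of p r lam] by (simp add: power_mult_distrib)
      then have wu: "w \<le> 2 * u"
        by (rule power2_le_imp_le) (simp add: u)
      \<comment> \<open>Both factors on the left of \<open>main\<close> then exceed \<open>2 u - w\<close> and \<open>2 u\<close>,
        which is too much: \<open>2 u w \<le> u\<^sup>2 + w\<^sup>2\<close> would leave \<open>u\<^sup>2 \<le> 0\<close>.\<close>
      have "(2 * u - w) * (2 * u) \<le> (x - y - w) * (x + y)"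
        using neg wu u(1) assms(9) by (intro mult_mono) auto
      then have le: "4 * u\<^sup>2 - 2 * (u * w) \<le> lam * r - lam * p"
        using main by (simp add: power2_eq_square algebra_simps)
      have "2 * (u * w) \<le> u\<^sup>2 + w\<^sup>2"
        using sum_squares_bound[of u w] by simp
      with le u w have "lam * r \<le> 0" by linarith
      then have "r = 0" using assms(3,6) by (simp add: mult_le_0_iff)
      then show False using r assms(5) by simp
    qed
    also have "2 * u \<le> 2 * sqrt (lam * max (1 / \<rho>\<^sup>2 * r0) r)"
      using assms(3) unfolding u_def by (intro mult_left_mono real_sqrt_le_mono) auto
    finally show ?thesis by simp
  qed
qed

text \<open>
  Splitting the noise term by \<open>2 a b \<le> a\<^sup>2 + b\<^sup>2\<close>, separately for \<open>x\<close> and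
  \<open>y\<close>, costs \<open>lam (p + r)\<close> in total; there the contribution of \<open>p\<close> cancels against
  the penalty of the estimator.
\<close>
lemma competitor_squared_norm_bound:
  fixes x y p r lam \<rho> :: real
  assumes basic: "x\<^sup>2 \<le> y\<^sup>2 + sqrt lam / \<rho> * sqrt (p + r) * (x + y) + lam * (r - p)"
    and "0 < lam" "1 \<le> \<rho>" "0 \<le> p" "0 \<le> r"
  shows "x\<^sup>2 \<le> (1 + 2 / (2 * \<rho>\<^sup>2 - 1)) * y\<^sup>2 + 2 * lam * (1 + 1 / (2 * \<rho>\<^sup>2 - 1)) * r"
proof -
  define w where "w = sqrt lam * sqrt (p + r)"
  have w2: "w\<^sup>2 = lam * (p + r)"
    using assms by (simp add: w_def power_mult_distrib)
  have split: "w * (z / \<rho>) \<le> w\<^sup>2 / 2 + (z\<^sup>2 / \<rho>\<^sup>2) / 2" for z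
    using sum_squares_bound[of w "z / \<rho>"] by (simp add: power_divide)
  have "sqrt lam / \<rho> * sqrt (p + r) * (x + y) = w * (x / \<rho>) + w * (y / \<rho>)"
    by (simp add: w_def algebra_simps add_divide_distrib)
  then have "x\<^sup>2 \<le> y\<^sup>2 + (w\<^sup>2 + (x\<^sup>2 / \<rho>\<^sup>2) / 2 + (y\<^sup>2 / \<rho>\<^sup>2) / 2) + lam * (r - p)"
    using basic split[of x] split[of y] by linarith
  also have "\<dots> = y\<^sup>2 + (x\<^sup>2 / \<rho>\<^sup>2) / 2 + (y\<^sup>2 / \<rho>\<^sup>2) / 2 + 2 * lam * r"
    by (simp add: w2 algebra_simps)
  finally have le: "x\<^sup>2 \<le> y\<^sup>2 + (x\<^sup>2 / \<rho>\<^sup>2) / 2 + (y\<^sup>2 / \<rho>\<^sup>2) / 2 + 2 * lam * r" .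
  have \<rho>: "1 \<le> \<rho>\<^sup>2" using assms(3) by simp
  have "x\<^sup>2 * (2 * \<rho>\<^sup>2 - 1) \<le> (2 * \<rho>\<^sup>2 + 1) * y\<^sup>2 + 4 * \<rho>\<^sup>2 * lam * r"
  proof -
    have "2 * \<rho>\<^sup>2 * x\<^sup>2 \<le> 2 * \<rho>\<^sup>2 * (y\<^sup>2 + (x\<^sup>2 / \<rho>\<^sup>2) / 2 + (y\<^sup>2 / \<rho>\<^sup>2) / 2 + 2 * lam * r)"
      using le by (rule mult_left_mono) simp
    also have "\<dots> = 2 * \<rho>\<^sup>2 * y\<^sup>2 + x\<^sup>2 + y\<^sup>2 + 4 * \<rho>\<^sup>2 * lam * r"
      using assms(3) by (simp add: distrib_left)
    finally show ?thesis by (simp add: algebra_simps)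
  qed
  then have "x\<^sup>2 \<le> ((2 * \<rho>\<^sup>2 + 1) * y\<^sup>2 + 4 * \<rho>\<^sup>2 * lam * r) / (2 * \<rho>\<^sup>2 - 1)"
    using \<rho> by (simp add: pos_le_divide_eq)
  also have "\<dots> = (1 + 2 / (2 * \<rho>\<^sup>2 - 1)) * y\<^sup>2 + 2 * lam * (1 + 1 / (2 * \<rho>\<^sup>2 - 1)) * r"
  proof -
    define d where "d = 2 * \<rho>\<^sup>2 - 1"
    have d: "d \<noteq> 0" "2 * \<rho>\<^sup>2 = d + 1" using \<rho> by (simp_all add: d_def)
    have "4 * \<rho>\<^sup>2 = 2 * (d + 1)" using d(2) by simp
    then have "((2 * \<rho>\<^sup>2 + 1) * y\<^sup>2 + 4 * \<rho>\<^sup>2 * lam * r) / d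
        = (1 + 2 / d) * y\<^sup>2 + 2 * lam * (1 + 1 / d) * r"
      using d(1) by (simp add: d(2) field_simps)
    then show ?thesis by (simp only: d_def)
  qed
  finally show ?thesis .
qed

theorem theorem2:
  fixes P :: "'w measure"
    and n :: nat
    and X :: "nat \<Rightarrow> 'w \<Rightarrow> real^'n^'m"
    and Y :: "nat \<Rightarrow> 'w \<Rightarrow> real"
    and A0 :: "real^'n^'m"
    and Ahat :: "'w \<Rightarrow> real^'n^'m"
    and \<mu> \<rho> lam :: real
    and \<omega> :: 'w
  assumes "trace_regression P n X Y A0"
    and "\<mu> > 0"
    and "\<forall>A :: real^'n^'m. (L2_norm P n X A)\<^sup>2 \<ge> inverse (\<mu>\<^sup>2) * (schatten_norm 2 A)\<^sup>2"
    and "\<rho> \<ge> 1"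
    and "lam > 0"
    and "\<omega> \<in> space P"
    and "Ahat \<omega> \<in> rank_penalized_estimators P n X Y lam \<omega>"
    and "sqrt lam \<ge> 2 * \<rho> * \<mu> * spectral_norm (noise_matrix P n X Y \<omega>)"
  shows "real (rank (Ahat \<omega>)) \<le> (1 + 2 / (4 * \<rho>\<^sup>2 - 1)) * real (rank A0)
    \<and> L2_norm P n X (Ahat \<omega> - A0)
        \<le> (INF A. L2_norm P n X (A - A0)
                    + 2 * sqrt (lam * max (1 / \<rho>\<^sup>2 * real (rank A0)) (real (rank A))))
    \<and> (L2_norm P n X (Ahat \<omega> - A0))\<^sup>2
        \<le> (INF A. (1 + 2 / (2 * \<rho>\<^sup>2 - 1)) * (L2_norm P n X (A - A0))\<^sup>2
                    + 2 * lam * (1 + 1 / (2 * \<rho>\<^sup>2 - 1)) * real (rank A))"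
proof -
  interpret trace_regression P n X Y A0 by fact
  let ?N = "L2_norm P n X" and ?M = "noise_matrix P n X Y \<omega>"
  define Ah where "Ah = Ahat \<omega>"
  define p where "p = real (rank Ah)"
  have est: "Ah \<in> rank_penalized_estimators P n X Y lam \<omega>"
    unfolding Ah_def by fact
  have c: "2 * \<mu> * spectral_norm ?M \<le> sqrt lam / \<rho>"
    using assms(4,8) by (simp add: pos_le_divide_eq mult_ac)
  have basic: "(?N (Ah - A0))\<^sup>2 \<le> (?N (A - A0))\<^sup>2
      + sqrt lam / \<rho> * sqrt (p + real (rank A)) * ?N (Ah - A) + lam * (real (rank A) - p)" for A
    using rank_penalized_estimator_basic_inequality[OF est, of A]
      noise_inner_le[of \<mu> \<omega> "sqrt lam / \<rho>" Ah A] assms(2,3) c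
    unfolding p_def by fastforce
  have risk: "(?N (Ah - A0))\<^sup>2 \<le> (?N (A - A0))\<^sup>2
      + sqrt lam / \<rho> * sqrt (p + real (rank A)) * (?N (Ah - A0) + ?N (A - A0))
      + lam * (real (rank A) - p)" for A
  proof -
    have "?N (Ah - A) \<le> ?N (Ah - A0) + ?N (A - A0)"
      using L2_norm_triangle[of "Ah - A0" "A - A0"] by simp
    then have "sqrt lam / \<rho> * sqrt (p + real (rank A)) * ?N (Ah - A)
        \<le> sqrt lam / \<rho> * sqrt (p + real (rank A)) * (?N (Ah - A0) + ?N (A - A0))"
      using assms(4,5) by (intro mult_left_mono) (auto simp: p_def)
    then show ?thesis using basic[of A] by linarith
  qed
  have rank: "p \<le> (1 + 2 / (4 * \<rho>\<^sup>2 - 1)) * real (rank A0)"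
  proof (rule competitor_rank_bound)
    show "(?N (Ah - A0))\<^sup>2 \<le> sqrt lam / \<rho> * sqrt (p + real (rank A0)) * ?N (Ah - A0)
        + lam * (real (rank A0) - p)"
      using basic[of A0] by (simp add: L2_norm_def L2_inner_def mat_inner_eq_inner)
  qed (use assms in \<open>auto simp: p_def\<close>)
  have norm: "?N (Ah - A0)
      \<le> ?N (A - A0) + 2 * sqrt (lam * max (1 / \<rho>\<^sup>2 * real (rank A0)) (real (rank A)))" for A
    using risk[of A] rank by (rule competitor_norm_bound) (use assms L2_norm_nonneg in \<open>auto simp: p_def\<close>)
  have sq: "(?N (Ah - A0))\<^sup>2 \<le> (1 + 2 / (2 * \<rho>\<^sup>2 - 1)) * (?N (A - A0))\<^sup>2
      + 2 * lam * (1 + 1 / (2 * \<rho>\<^sup>2 - 1)) * real (rank A)" for A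
    using risk[of A] by (rule competitor_squared_norm_bound) (use assms in \<open>auto simp: p_def\<close>)
  show ?thesis
    using rank norm sq unfolding p_def Ah_def by (intro conjI cINF_greatest) auto
qed

end
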